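(* Let $f:\mathbb{R}^n\to\mathbb{R}$ be continuously differentiable and bounded below on the level set $L(x_0)=\{x\in\mathbb{R}^n : f(x)\le f(x_0)\}$. Let $\{x_k\}$ be an infinite sequence generated by the nonmonotone trust-region algorithm NMTR described in the context, started at $x_0$, with either choice of the nonmonotone term $T_k$, and suppose there is a constant $M>0$ with $\|B_k\|\le M$ for all $k$. Then $$\liminf_{k\to\infty}\|\nabla f(x_k)\|=0.$$
   Context: Notation: $f_k=f(x_k)$, $g_k=\nabla f(x_k)$, $\|\cdot\|$ is a fixed norm on $\mathbb{R}^n$ (and the induced matrix norm), $B_k\in\mathbb{R}^{n\times n}$ is a symmetric matrix (approximation of the Hessian at $x_k$; the update rule is arbitrary), and $q_k(d)=f_k+g_k^Td+\frac12 d^TB_kd$. Nonmonotone terms: Fix an integer $N\ge 1$ and weights $\eta_i\in[0,1)$, $i\ge 0$. Put $m(k)=\min\{k,N\}$ and $f_{l(k)}=\max_{0\le j\le m(k)} f_{k-j}$. Define $\overline{T}_0=f_0$; for $1\le k<N$, $\overline{T}_k=(1-\eta_{k-1})f_k+\eta_{k-1}\overline{T}_{k-1}$; and for $k\ge N$, $$\overline{T}_k=(1-\eta_{k-1})f_k+\eta_{k-1}(1-\eta_{k-2})f_{k-1}+\cdots+\eta_{k-1}\cdots\eta_{k-N+1}(1-\eta_{k-N})f_{k-N+1}+\eta_{k-1}\cdots\eta_{k-N}f_{k-N}.$$ The term $T_k$ is one of the following two choices (the same choice for all $k$). First choice: $T_0=f_0$, $T_k=f_k+\eta_{k-1}(\overline{T}_k-f_k)$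 if $1\le k<N$, and $T_k=\max\{\overline{T}_k,f_k\}$ if $k\ge N$. Second choice: $T_k=f_{l(k)}$ if $k<N$, and $T_k=\max\{\overline{T}_k,f_k\}$ if $k\ge N$. Algorithm NMTR: Parameters $0<\mu_1\le\mu_2<1$ and $0<\rho_1<1\le\rho_2$. Start from $x_0$ with $\delta_0=\|g_0\|$. At iterate $x_k$ with radius $\delta_k$, compute a trial step $d_k$ as a (possibly approximate) solution of: minimize $q_k(d)$ subject to $\|d\|\le\delta_k$; in particular $\|d_k\|\le\delta_k$. Compute $$\widehat r_k=\frac{T_k-f(x_k+d_k)}{q_k(0)-q_k(d_k)}.$$ Inner cycle: while $\widehat r_k<\mu_1$, replace $\delta_k$ by $\rho_1\delta_k$, recompute the trial step $d_k$ for the new radius, and recompute $\widehat r_k$. When $\widehat r_k\ge\mu_1$, set $x_{k+1}=x_k+d_k$ (successful iteration). If $\widehat r_k\ge\mu_2$ the iteration is very successful and $\delta_{k+1}=\rho_2\delta_k$; otherwise $\delta_{k+1}=\delta_k$ (here $\delta_k$ is the value at the end of the inner cycle). Then choose $B_{k+1}$ and increase $k$ by one. The stopping test is disregarded, so that an infinite sequence is generated, and $g_k\ne0$ for all $k$. Standing assumption (sufficient reduction): there is a constant $\beta\in(0,1)$ such that every computed trial step satisfies $q_k(0)-q_k(d_k)\ge\beta\|g_k\|\min\{\delta_k,\|g_k\|/\|B_k\|\}$, where $\delta_k$ is the radius used for that trial step (and $\|g_k\|/\|B_k\|=+\infty$ if $B_k=0$). *)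

theory Defs
  imports "HOL-Analysis.Analysis"
begin

definition is_norm :: "('a::real_vector \<Rightarrow> real) \<Rightarrow> bool" where
  "is_norm nrm \<longleftrightarrow>
     (\<forall>x. nrm x \<ge> 0) \<and> (\<forall>x. nrm x = 0 \<longleftrightarrow> x = 0) \<and>
     (\<forall>c x. nrm (c *\<^sub>R x) = \<bar>c\<bar> * nrm x) \<and> (\<forall>x y. nrm (x + y) \<le> nrm x + nrm y)"

text \<open>The library's \<^const>\<open>onorm\<close> is tied to the Euclidean norm of \<^typ>\<open>real ^ 'n\<close>; here the
  vector norm is arbitrary. For a norm the set below is nonempty and bounded above, so the
  supremum is a genuine one.\<close>

definition induced_norm :: "(real ^ 'n \<Rightarrow> real) \<Rightarrow> real ^ 'n ^ 'n \<Rightarrow> real" where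
  "induced_norm nrm A = (SUP v\<in>{v. nrm v = 1}. nrm (A *v v))"

definition quad_model :: "real \<Rightarrow> real ^ 'n \<Rightarrow> real ^ 'n ^ 'n \<Rightarrow> real ^ 'n \<Rightarrow> real" where
  "quad_model c g B d = c + g \<bullet> d + (d \<bullet> (B *v d)) / 2"

text \<open>In the following four definitions \<^term>\<open>F k\<close> stands for \<open>f (x\<^sub>k)\<close>.\<close>

definition f_max :: "nat \<Rightarrow> (nat \<Rightarrow> real) \<Rightarrow> nat \<Rightarrow> real" where
  "f_max N F k = Max ((\<lambda>j. F (k - j)) ` {0..min k N})"

text \<open>Only used for \<^term>\<open>N \<ge> 1\<close>, so that index \<open>0\<close> always falls into the range \<open>k < N\<close>.\<close>

fun T_bar :: "nat \<Rightarrow> (nat \<Rightarrow> real) \<Rightarrow> (nat \<Rightarrow> real) \<Rightarrow> nat \<Rightarrow> real" where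
  "T_bar N \<eta> F 0 = F 0"
| "T_bar N \<eta> F (Suc k) =
     (if Suc k < N then (1 - \<eta> k) * F (Suc k) + \<eta> k * T_bar N \<eta> F k
      else (\<Sum>j<N. (\<Prod>i=1..j. \<eta> (Suc k - i)) * (1 - \<eta> (Suc k - (j + 1))) * F (Suc k - j))
           + (\<Prod>i=1..N. \<eta> (Suc k - i)) * F (Suc k - N))"

definition T_first :: "nat \<Rightarrow> (nat \<Rightarrow> real) \<Rightarrow> (nat \<Rightarrow> real) \<Rightarrow> nat \<Rightarrow> real" where
  "T_first N \<eta> F k =
     (if k = 0 then F 0
      else if k < N then F k + \<eta> (k - 1) * (T_bar N \<eta> F k - F k)
      else max (T_bar N \<eta> F k) (F k))"

definition T_second :: "nat \<Rightarrow> (nat \<Rightarrow> real) \<Rightarrow> (nat \<Rightarrow> real) \<Rightarrow> nat \<Rightarrow> real" where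
  "T_second N \<eta> F k = (if k < N then f_max N F k else max (T_bar N \<eta> F k) (F k))"

definition ratio ::
  "(real ^ 'n \<Rightarrow> real) \<Rightarrow> (real ^ 'n \<Rightarrow> real ^ 'n) \<Rightarrow> real ^ 'n ^ 'n \<Rightarrow> real \<Rightarrow> real ^ 'n \<Rightarrow> real ^ 'n \<Rightarrow> real"
where
  "ratio f g B T x d =
     (T - f (x + d)) / (quad_model (f x) (g x) B 0 - quad_model (f x) (g x) B d)"

text \<open>A run of the algorithm. \<^term>\<open>\<Delta> k\<close> is the radius on entry to iteration \<^term>\<open>k\<close>, whose inner
  cycle rejects the trial steps \<^term>\<open>d k i\<close> for \<^term>\<open>i < p k\<close> and accepts \<^term>\<open>d k (p k)\<close>; the trial
  step \<^term>\<open>d k i\<close> is computed with radius \<^term>\<open>\<rho>1 ^ i * \<Delta> k\<close>. Values \<^term>\<open>d k i\<close> with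
  \<^term>\<open>i > p k\<close> are never computed and are unconstrained.\<close>

definition NMTR_run ::
  "(real ^ 'n \<Rightarrow> real) \<Rightarrow> real \<Rightarrow> real \<Rightarrow> real \<Rightarrow> real \<Rightarrow>
   (real ^ 'n \<Rightarrow> real) \<Rightarrow> (real ^ 'n \<Rightarrow> real ^ 'n) \<Rightarrow> (nat \<Rightarrow> real ^ 'n ^ 'n) \<Rightarrow> (nat \<Rightarrow> real) \<Rightarrow>
   (nat \<Rightarrow> real ^ 'n) \<Rightarrow> (nat \<Rightarrow> real) \<Rightarrow> (nat \<Rightarrow> nat) \<Rightarrow> (nat \<Rightarrow> nat \<Rightarrow> real ^ 'n) \<Rightarrow> bool"
where
  "NMTR_run nrm \<mu>1 \<mu>2 \<rho>1 \<rho>2 f g B T x \<Delta> p d \<longleftrightarrow>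
     \<Delta> 0 = nrm (g (x 0)) \<and>
     (\<forall>k.
        (\<forall>i\<le>p k. nrm (d k i) \<le> \<rho>1 ^ i * \<Delta> k) \<and>
        (\<forall>i<p k. ratio f g (B k) (T k) (x k) (d k i) < \<mu>1) \<and>
        ratio f g (B k) (T k) (x k) (d k (p k)) \<ge> \<mu>1 \<and>
        x (Suc k) = x k + d k (p k) \<and>
        \<Delta> (Suc k) = (if ratio f g (B k) (T k) (x k) (d k (p k)) \<ge> \<mu>2
                      then \<rho>2 * (\<rho>1 ^ p k * \<Delta> k) else \<rho>1 ^ p k * \<Delta> k))"

text \<open>The quotient in the minimum is read as plus infinity when the matrix vanishes.\<close>

definition sufficient_reduction ::
  "(real ^ 'n \<Rightarrow> real) \<Rightarrow> real \<Rightarrow> real \<Rightarrow> real ^ 'n \<Rightarrow> real ^ 'n ^ 'n \<Rightarrow> real \<Rightarrow> real ^ 'n \<Rightarrow> bool"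
where
  "sufficient_reduction nrm \<beta> c g B \<delta> d \<longleftrightarrow>
     quad_model c g B 0 - quad_model c g B d \<ge>
       \<beta> * nrm g * (if B = 0 then \<delta> else min \<delta> (nrm g / induced_norm nrm B))"

end

theory Submission
  imports Defs
begin

text \<open>
  The proof is by contradiction: suppose that the gradients along the run stay bounded away from
  zero, say \<open>nrm (g (x k)) \<ge> \<epsilon>\<close>. Write \<open>s k\<close> for the radius at which iteration \<open>k\<close>
  accepts its step.

  The nonmonotone term never exceeds the largest of the last \<open>N + 1\<close> function values
  (\<open>nonmonotone_term_le_f_max\<close>), because \<open>T_bar\<close> is a convex combination of them. An accepted
  step therefore puts the new value below this windowed maximum by at least a multiple of
  \<open>a k = min (s k) (\<epsilon> / M)\<close>. Within \<open>N + 1\<close> steps every value in the window has been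
  replaced, so the windowed maximum falls by a multiple of the \<^emph>\<open>smallest\<close> \<open>a i\<close> of those
  steps, and boundedness below makes these minima summable.

  Such minima alone would not control the long steps in each window. What does control them is that
  a radius grows by a factor of at most \<open>\<rho>2\<close> per iteration: hence \<open>a (k + N + 1)\<close> is at most
  \<open>\<rho>2 ^ (N + 1)\<close> times the minimum over the window that starts at \<open>k\<close>, and \<open>a\<close> itself is
  summable (\<open>summable_windowed_descent\<close>). So the accepted radii are summable, the iterates form a
  Cauchy sequence, and they converge to some \<open>z\<close>. The estimates below are
  therefore local ones at a single point, where continuity of the gradient provides them.

  Near \<open>z\<close>, the error of the quadratic model is small compared with the radius, uniformly in the
  base point, whereas the predicted reduction is at least \<open>\<beta> \<epsilon>\<close> times the radius. Every trial
  step of small radius is then very successful (\<open>ratio_ge_near_point\<close>), so from some iteration on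
  nothing is rejected and the radius never decreases. As the radius is positive, this contradicts its
  convergence to zero.
\<close>

section \<open>Arbitrary norms on a finite-dimensional space\<close>

text \<open>A norm is convex, hence continuous in finite dimension, so it attains a positive minimum and a
  maximum on the Euclidean unit sphere; homogeneity extends the two bounds to the whole space.\<close>

lemma is_norm_equivalent:
  fixes nrm :: "'a::euclidean_space \<Rightarrow> real"
  assumes "is_norm nrm"
  obtains c C where "c > 0" "C > 0" "\<And>x. c * norm x \<le> nrm x" "\<And>x. nrm x \<le> C * norm x"
proof -
  have nonneg: "nrm v \<ge> 0" and zero: "nrm v = 0 \<longleftrightarrow> v = 0"
    and scale: "nrm (t *\<^sub>R v) = \<bar>t\<bar> * nrm v" and tri: "nrm (v + w) \<le> nrm v + nrm w" for t v w
    using assms by (auto simp: is_norm_def)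
  have "convex_on UNIV nrm"
  proof (rule convex_onI)
    fix t :: real and v w assume t: "0 < t" "t < 1"
    show "nrm ((1 - t) *\<^sub>R v + t *\<^sub>R w) \<le> (1 - t) * nrm v + t * nrm w"
      using tri[of "(1 - t) *\<^sub>R v" "t *\<^sub>R w"] scale t by simp
  qed auto
  then have "continuous_on UNIV nrm"
    by (intro convex_on_continuous) auto
  then have cont: "continuous_on (sphere 0 1) nrm"
    by (rule continuous_on_subset) auto
  have ne: "sphere (0::'a) 1 \<noteq> {}" by simp
  obtain u where u: "u \<in> sphere 0 1" "\<And>v. v \<in> sphere 0 1 \<Longrightarrow> nrm u \<le> nrm v"
    using continuous_attains_inf[OF compact_sphere ne cont] by auto
  obtain w where w: "w \<in> sphere 0 1" "\<And>v. v \<in> sphere 0 1 \<Longrightarrow> nrm v \<le> nrm w"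
    using continuous_attains_sup[OF compact_sphere ne cont] by auto
  have pos: "nrm v > 0" if "v \<in> sphere 0 1" for v
    using that nonneg[of v] zero[of v] by force
  have hom: "nrm v = norm v * nrm (v /\<^sub>R norm v) \<and> v /\<^sub>R norm v \<in> sphere 0 1" if "v \<noteq> 0" for v
    using that by (simp add: scale)
  show thesis
  proof
    show "nrm u > 0" "nrm w > 0" using pos u w by auto
    show "nrm u * norm v \<le> nrm v" for v
    proof (cases "v = 0")
      case False
      then show ?thesis using hom[of v] u(2)[of "v /\<^sub>R norm v"]
        by (metis mult.commute mult_right_mono norm_ge_zero)
    qed (simp add: nonneg)
    show "nrm v \<le> nrm w * norm v" for v
    proof (cases "v = 0")
      case False
      then show ?thesis using hom[of v] w(2)[of "v /\<^sub>R norm v"]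
        by (metis mult.commute mult_right_mono norm_ge_zero)
    qed (use zero[of v] in simp)
  qed
qed

text \<open>Finite dimension enters through boundedness of the set whose supremum is the induced norm:
  on an unbounded set of reals \<^const>\<open>Sup\<close> would carry no information.\<close>

lemma nrm_matrix_vector_le:
  fixes A :: "real ^ 'n ^ 'n"
  assumes nrm: "is_norm nrm"
  shows "nrm (A *v v) \<le> induced_norm nrm A * nrm v"
proof (cases "v = 0")
  case True
  moreover have "nrm 0 = 0" using nrm by (simp add: is_norm_def)
  ultimately show ?thesis by simp
next
  case False
  have pos: "nrm v > 0"
    using nrm False unfolding is_norm_def by (metis less_le)
  have scale: "nrm (t *\<^sub>R v) = \<bar>t\<bar> * nrm v" for t v
    using nrm by (auto simp: is_norm_def)
  obtain c C where c: "c > 0" "C > 0" "\<And>x. c * norm x \<le> nrm x" "\<And>x. nrm x \<le> C * norm x"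
    using is_norm_equivalent[OF nrm] by blast
  obtain K where K: "K > 0" "\<And>x. norm (A *v x) \<le> K * norm x"
    using bounded_linear.pos_bounded[OF matrix_vector_mul_bounded_linear[of A]]
    by (metis mult.commute)
  have "bdd_above ((\<lambda>v. nrm (A *v v)) ` {v. nrm v = 1})"
  proof (rule bdd_aboveI2)
    fix w assume "w \<in> {v. nrm v = 1}"
    then have "norm w \<le> 1 / c" using c(1) c(3)[of w] by (simp add: field_simps)
    have "nrm (A *v w) \<le> C * (K * norm w)"
      using c(4)[of "A *v w"] K(2)[of w] c(2) by (meson mult_left_mono less_imp_le order_trans)
    also have "\<dots> \<le> C * (K * (1 / c))"
      using c(2) K(1) \<open>norm w \<le> 1 / c\<close> by (intro mult_left_mono) auto
    finally show "nrm (A *v w) \<le> C * (K * (1 / c))" .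
  qed
  then have "nrm (A *v (v /\<^sub>R nrm v)) \<le> induced_norm nrm A"
    unfolding induced_norm_def by (rule cSUP_upper[rotated]) (use pos scale in simp)
  then show ?thesis
    using pos by (simp add: matrix_vector_mult_scaleR scale field_simps)
qed

text \<open>Guarantees that the quotient \<open>nrm g / induced_norm nrm B\<close> in the sufficient reduction is
  never a division by zero for \<open>B \<noteq> 0\<close>.\<close>

lemma induced_norm_pos:
  fixes A :: "real ^ 'n ^ 'n"
  assumes nrm: "is_norm nrm" and "A \<noteq> 0"
  shows "induced_norm nrm A > 0"
proof -
  obtain v where v: "A *v v \<noteq> 0"
    using \<open>A \<noteq> 0\<close> by (metis matrix_eq matrix_vector_mult_0)
  then have "v \<noteq> 0" by auto
  then have "nrm (A *v v) > 0" "nrm v > 0"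
    using nrm v unfolding is_norm_def by (metis less_le)+
  then show ?thesis
    using nrm_matrix_vector_le[OF nrm, of A v] by (metis less_le_trans zero_less_mult_pos2)
qed

section \<open>The nonmonotone terms\<close>

text \<open>For \<open>a i \<in> [0, 1]\<close>, stop at stage \<open>j + 1\<close> with probability \<open>1 - a (j + 1)\<close>, given no
  earlier stop: the weights are the distribution of the stopping stage, cut off at \<open>n\<close>.
  These are the weights in \<^const>\<open>T_bar\<close>.\<close>

lemma convex_weights_sum:
  fixes a :: "nat \<Rightarrow> real"
  shows "(\<Sum>j<n. (\<Prod>i=1..j. a i) * (1 - a (j + 1))) + (\<Prod>i=1..n. a i) = 1"
  by (induction n) (auto simp: algebra_simps)

lemma T_bar_le:
  assumes \<eta>: "\<And>i. 0 \<le> \<eta> i \<and> \<eta> i < 1" and F: "\<And>j. j \<le> min k N \<Longrightarrow> F (k - j) \<le> b"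
  shows "T_bar N \<eta> F k \<le> b"
proof (cases "k < N")
  case True
  then have "\<forall>j\<le>k. F j \<le> b"
    using F[of "k - j" for j] by (metis diff_diff_cancel diff_le_self less_imp_le min.absorb1)
  then show ?thesis using True
  proof (induction k)
    case (Suc k)
    then have "F (Suc k) \<le> b" "T_bar N \<eta> F k \<le> b" by auto
    then have "(1 - \<eta> k) * F (Suc k) + \<eta> k * T_bar N \<eta> F k \<le> (1 - \<eta> k) * b + \<eta> k * b"
      using \<eta>[of k] by (intro add_mono mult_left_mono) auto
    then show ?case using Suc.prems by (simp add: algebra_simps)
  qed simp
next
  case False
  show ?thesis
  proof (cases k)
    case 0
    then show ?thesis using F[of 0] by simp
  next
    case (Suc m)
    let ?P = "\<lambda>j. \<Prod>i=1..j. \<eta> (k - i)"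
    have P: "?P j \<ge> 0" for j using \<eta> by (simp add: prod_nonneg)
    have "T_bar N \<eta> F k = (\<Sum>j<N. ?P j * (1 - \<eta> (k - (j + 1))) * F (k - j)) + ?P N * F (k - N)"
      using False Suc by simp
    also have "\<dots> \<le> (\<Sum>j<N. ?P j * (1 - \<eta> (k - (j + 1))) * b) + ?P N * b"
      using P \<eta> False by (intro add_mono sum_mono mult_left_mono mult_nonneg_nonneg F) (auto intro: less_imp_le)
    also have "\<dots> = ((\<Sum>j<N. ?P j * (1 - \<eta> (k - (j + 1)))) + ?P N) * b"
      by (simp only: sum_distrib_right distrib_right)
    also have "\<dots> = b"
      using convex_weights_sum[of "\<lambda>i. \<eta> (k - i)" N] by simp
    finally show ?thesis .
  qed
qed

lemma f_max_ge: "j \<le> min k N \<Longrightarrow> F (k - j) \<le> f_max N F k"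
  unfolding f_max_def by (intro Max_ge) auto

lemma f_max_le: "(\<And>j. j \<le> min k N \<Longrightarrow> F (k - j) \<le> b) \<Longrightarrow> f_max N F k \<le> b"
  unfolding f_max_def by (subst Max_le_iff) auto

lemma nonmonotone_term_le_f_max:
  assumes \<eta>: "\<And>i. 0 \<le> \<eta> i \<and> \<eta> i < 1"
    and T: "T = T_first N \<eta> F \<or> T = T_second N \<eta> F"
  shows "T k \<le> f_max N F k"
proof -
  have bar: "T_bar N \<eta> F k \<le> f_max N F k"
    using \<eta> by (rule T_bar_le) (rule f_max_ge)
  have cur: "F k \<le> f_max N F k"
    using f_max_ge[of 0 k N F] by simp
  have "(1 - \<eta> (k - 1)) * F k + \<eta> (k - 1) * T_bar N \<eta> F k
      \<le> (1 - \<eta> (k - 1)) * f_max N F k + \<eta> (k - 1) * f_max N F k"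
    using \<eta>[of "k - 1"] bar cur by (intro add_mono mult_left_mono) auto
  then show ?thesis
    using T bar cur by (auto simp: T_first_def T_second_def algebra_simps)
qed

text \<open>Restricted to \<open>k \<ge> N\<close>, because \<^const>\<open>T_first\<close> may lie below the current value in
  the starting phase; only the limiting behaviour of a run depends on this bound.\<close>

lemma nonmonotone_term_ge:
  assumes "T = T_first N \<eta> F \<or> T = T_second N \<eta> F" and "N \<ge> 1" and "k \<ge> N"
  shows "F k \<le> T k"
  using assms by (auto simp: T_first_def T_second_def)

section \<open>Summability from descent of a windowed maximum\<close>

text \<open>When the window moves by one step, its only new entry is bounded by the old maximum.\<close>

lemma f_max_antimono:
  assumes "\<And>k. F (Suc k) \<le> f_max N F k"
  shows "f_max N F (k + i) \<le> f_max N F k"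
proof (induction i)
  case (Suc i)
  have "f_max N F (Suc (k + i)) \<le> f_max N F (k + i)"
  proof (rule f_max_le)
    fix j assume j: "j \<le> min (Suc (k + i)) N"
    show "F (Suc (k + i) - j) \<le> f_max N F (k + i)"
    proof (cases j)
      case 0
      then show ?thesis using assms by simp
    next
      case (Suc j')
      then show ?thesis using j f_max_ge[of j' "k + i" N F] by simp
    qed
  qed
  then show ?case using Suc by simp
qed simp

text \<open>After \<open>N + 1\<close> steps the whole window consists of values that have each dropped below the old
  maximum, so the maximum decreases by \<open>c\<close> times the minimum of \<open>a\<close> over these steps. The growth
  condition bounds the next term of \<open>a\<close> by a constant times that minimum, which turns summability
  of the minima into summability of \<open>a\<close>.\<close>

lemma summable_windowed_descent:
  fixes F a :: "nat \<Rightarrow> real"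
  assumes descent: "\<And>k. F (Suc k) \<le> f_max N F k - c * a k" and "c > 0"
    and a: "\<And>k. a k \<ge> 0" and growth: "\<And>k. a (Suc k) \<le> \<rho> * a k" and \<rho>: "\<rho> \<ge> 1"
    and lower: "\<And>k. L \<le> F k"
  shows "summable a"
proof -
  define R where "R = f_max N F"
  define W where "W = Suc N"
  define m where "m k = Min (a ` {k..<k + W})" for k
  have m_nonneg: "m k \<ge> 0" for k
    unfolding m_def W_def using a by (subst Min_ge_iff) auto
  have m_le: "m k \<le> a i" if "k \<le> i" "i < k + W" for k i
    unfolding m_def using that by (intro Min_le) auto
  have anti: "R (k + i) \<le> R k" for k i
    unfolding R_def
  proof (rule f_max_antimono)
    show "F (Suc k) \<le> f_max N F k" for k
      using descent[of k] \<open>c > 0\<close> a[of k] by (smt (verit) mult_nonneg_nonneg)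
  qed
  have drop: "R (k + W) + c * m k \<le> R k" for k
  proof -
    have "R (k + W) \<le> R k - c * m k"
      unfolding R_def
    proof (rule f_max_le)
      fix j assume j: "j \<le> min (k + W) N"
      define i where "i = N - j"
      have i: "k + W - j = Suc (k + i)" "k + i < k + W" using j by (auto simp: i_def W_def)
      have "F (Suc (k + i)) \<le> R (k + i) - c * a (k + i)"
        using descent by (simp add: R_def)
      moreover have "c * m k \<le> c * a (k + i)"
        using m_le[of k "k + i"] i(2) \<open>c > 0\<close> by simp
      ultimately show "F (k + W - j) \<le> f_max N F k - c * m k"
        using anti[of k i] i(1) by (simp add: R_def)
    qed
    then show ?thesis by simp
  qed
  have R_lower: "L \<le> R k" for k
    using lower[of k] f_max_ge[of 0 k N F] by (simp add: R_def)
  \<comment> \<open>The sum telescopes at distance \<open>W\<close>, which leaves \<open>W\<close> terms at either end.\<close>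
  have tele: "(\<Sum>k<n. c * m k) \<le> (\<Sum>i<W. R i) - (\<Sum>i<W. R (n + i))" for n
  proof (induction n)
    case (Suc n)
    have "(\<Sum>i<W. R (Suc n + i)) + R n = (\<Sum>i<W. R (n + i)) + R (n + W)"
      by (induction W) auto
    then show ?case using Suc drop[of n] by simp
  qed simp
  have "(\<Sum>i<W. L) \<le> (\<Sum>i<W. R (n + i))" for n
    using R_lower by (intro sum_mono) auto
  then have "(\<Sum>k<n. c * m k) \<le> (\<Sum>i<W. R i) - (\<Sum>i<W. L)" for n
    using tele[of n] by (meson diff_left_mono order_trans)
  then have "summable (\<lambda>k. c * m k)"
    using m_nonneg \<open>c > 0\<close> by (intro summableI_nonneg_bounded) auto
  then have "summable m" using \<open>c > 0\<close> by simp
  have power_growth: "a (i + n) \<le> \<rho> ^ n * a i" for i n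
  proof (induction n)
    case (Suc n)
    have "a (i + Suc n) \<le> \<rho> * a (i + n)" using growth by simp
    also have "\<dots> \<le> \<rho> * (\<rho> ^ n * a i)" using Suc \<rho> by (intro mult_left_mono) auto
    finally show ?case by (simp add: mult.assoc)
  qed simp
  have "a (k + W) \<le> \<rho> ^ W * m k" for k
  proof -
    have "m k \<in> a ` {k..<k + W}"
      unfolding m_def W_def by (intro Min_in) auto
    then obtain i where i: "i \<ge> k" "i < k + W" "m k = a i" by auto
    have "a (k + W) \<le> \<rho> ^ (k + W - i) * a i"
      using power_growth[of i "k + W - i"] i by simp
    also have "\<dots> \<le> \<rho> ^ W * a i"
      using i \<rho> a by (intro mult_right_mono power_increasing) auto
    finally show ?thesis using i by simp
  qed
  then have "norm (a (k + W)) \<le> \<rho> ^ W * m k" for k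
    using a by simp
  then have "summable (\<lambda>k. a (k + W))"
    using summable_mult[OF \<open>summable m\<close>] by (blast intro: summable_comparison_test')
  then show ?thesis using summable_iff_shift[of a W] by blast
qed

lemma convergent_of_summable_steps:
  fixes x :: "nat \<Rightarrow> 'a::banach"
  assumes "summable s" and "\<And>k. norm (x (Suc k) - x k) \<le> s k"
  shows "convergent x"
proof -
  have "summable (\<lambda>k. x (Suc k) - x k)"
    using assms(1) by (rule summable_comparison_test'[where N = 0]) (rule assms(2))
  then have "convergent (\<lambda>n. x n - x 0)"
    unfolding summable_iff_convergent sum_lessThan_telescope .
  then show ?thesis
    by (metis convergent_diff_const_right_iff)
qed

section \<open>Agreement of the model with the objective near a point\<close>

text \<open>Continuity of the gradient at \<open>z\<close> makes the first-order expansion uniform in the base point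
  near \<open>z\<close>: apply the mean value inequality to \<open>w \<mapsto> f w - g u \<bullet> w\<close>, whose gradient is small
  on the ball.\<close>

lemma strictly_differentiable:
  fixes f :: "'a::real_inner \<Rightarrow> real"
  assumes f: "\<And>y. GDERIV f y :> g y" and g: "isCont g z" and e: "e > 0"
  obtains r where "r > 0"
    "\<And>u v. u \<in> ball z r \<Longrightarrow> v \<in> ball z r \<Longrightarrow> \<bar>f v - f u - g u \<bullet> (v - u)\<bar> \<le> e * norm (v - u)"
proof -
  obtain r where r: "r > 0" "\<And>w. dist w z < r \<Longrightarrow> dist (g w) (g z) < e / 2"
    using g e unfolding continuous_at by (metis (no_types) g continuous_at_eps_delta half_gt_zero)
  show thesis
  proof
    show "r > 0" by fact
    fix u v assume uv: "u \<in> ball z r" "v \<in> ball z r"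
    have "norm ((\<lambda>w. f w - g u \<bullet> w) v - (\<lambda>w. f w - g u \<bullet> w) u) \<le> e * norm (v - u)"
    proof (rule differentiable_bound[OF convex_ball _ _ uv(2) uv(1)])
      fix w assume w: "w \<in> ball z r"
      show "((\<lambda>w. f w - g u \<bullet> w) has_derivative (\<lambda>h. (g w - g u) \<bullet> h)) (at w within ball z r)"
      proof -
        have "(f has_derivative (\<lambda>h. g w \<bullet> h)) (at w within ball z r)"
          using f[of w] by (simp add: gderiv_def inner_commute has_derivative_at_withinI)
        from has_derivative_diff[OF this
            bounded_linear_imp_has_derivative[OF bounded_linear_inner_right[of "g u"]]]
        show ?thesis by (simp add: inner_diff_left)
      qed
      have "norm (g w - g u) \<le> e"
        using r(2)[of w] r(2)[of u] w uv dist_triangle2[of "g w" "g u" "g z"]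
        by (simp add: dist_commute dist_norm[symmetric])
      then show "onorm (\<lambda>h. (g w - g u) \<bullet> h) \<le> e"
        using e by (intro onorm_bound) (auto intro: order_trans[OF Cauchy_Schwarz_ineq2 mult_right_mono])
    qed
    then show "\<bar>f v - f u - g u \<bullet> (v - u)\<bar> \<le> e * norm (v - u)"
      by (simp add: inner_diff_right algebra_simps)
  qed
qed

text \<open>Replaces the reduction bound, which depends on the current gradient and matrix, by one in
  terms of the radius and of constants of the whole run.\<close>

lemma predicted_reduction_ge:
  assumes nrm: "is_norm nrm"
    and red: "sufficient_reduction nrm \<beta> c gk B \<delta> d"
    and "\<beta> > 0" "\<epsilon> > 0" "M > 0" "\<delta> > 0" "nrm gk \<ge> \<epsilon>" "induced_norm nrm B \<le> M"
  shows "quad_model c gk B 0 - quad_model c gk B d \<ge> \<beta> * \<epsilon> * min \<delta> (\<epsilon> / M)"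
proof -
  have "min \<delta> (\<epsilon> / M) \<le> (if B = 0 then \<delta> else min \<delta> (nrm gk / induced_norm nrm B))"
  proof (cases "B = 0")
    case False
    then have "\<epsilon> / M \<le> nrm gk / induced_norm nrm B"
      using induced_norm_pos[OF nrm False] assms by (intro frac_le) auto
    then show ?thesis using False by auto
  qed auto
  moreover have "\<beta> * \<epsilon> \<le> \<beta> * nrm gk" "0 \<le> min \<delta> (\<epsilon> / M)" using assms by auto
  ultimately have "\<beta> * \<epsilon> * min \<delta> (\<epsilon> / M)
      \<le> \<beta> * nrm gk * (if B = 0 then \<delta> else min \<delta> (nrm gk / induced_norm nrm B))"
    using assms by (intro mult_mono) auto
  then show ?thesis
    using red unfolding sufficient_reduction_def by linarith
qed

text \<open>For small \<open>\<delta>\<close> the predicted reduction is at least \<open>\<beta> \<epsilon> \<delta>\<close>, while it differs from the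
  actual one by a first-order error \<open>o(\<delta>)\<close> and a second-order term \<open>O(\<delta>\<^sup>2)\<close>. The ratio is
  therefore at least \<open>1 - o(1)\<close>, and eventually exceeds any given \<open>\<mu> < 1\<close>.\<close>

lemma ratio_ge_near_point:
  fixes nrm :: "real ^ 'n \<Rightarrow> real"
  assumes nrm: "is_norm nrm"
    and f: "\<And>y. GDERIV f y :> g y" and g: "isCont g z"
    and pos: "\<beta> > 0" "\<epsilon> > 0" "M > 0" and \<mu>: "\<mu> < 1"
  obtains r where "r > 0"
    "\<And>y d B \<delta> t. norm (y - z) < r \<Longrightarrow> 0 < \<delta> \<Longrightarrow> \<delta> < r \<Longrightarrow> nrm d \<le> \<delta> \<Longrightarrow> nrm (g y) \<ge> \<epsilon> \<Longrightarrow>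
      induced_norm nrm B \<le> M \<Longrightarrow> sufficient_reduction nrm \<beta> (f y) (g y) B \<delta> d \<Longrightarrow> f y \<le> t \<Longrightarrow>
      \<mu> \<le> ratio f g B t y d"
proof -
  obtain c where c: "c > 0" "\<And>x. c * norm x \<le> nrm x"
    by (rule is_norm_equivalent[OF nrm]) (rule that)
  \<comment> \<open>Each of the two model errors may use half of the slack \<open>(1 - \<mu>) * \<beta> * \<epsilon> * \<delta>\<close>.\<close>
  define \<kappa> where "\<kappa> = (1 - \<mu>) * \<beta> * \<epsilon> / 2"
  have \<kappa>: "\<kappa> > 0" using pos \<mu> by (simp add: \<kappa>_def)
  obtain r0 where r0: "r0 > 0" "\<And>u v. u \<in> ball z r0 \<Longrightarrow> v \<in> ball z r0 \<Longrightarrow>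
      \<bar>f v - f u - g u \<bullet> (v - u)\<bar> \<le> (\<kappa> * c) * norm (v - u)"
    using strictly_differentiable[OF f g, of "\<kappa> * c"] \<kappa> c by auto
  \<comment> \<open>The first two entries keep \<open>y\<close> and \<open>y + d\<close> in the ball of radius \<open>r0\<close>, the third makes
    \<open>\<delta>\<close> the smaller argument of the minimum in the predicted reduction, and the fourth bounds the
    quadratic term.\<close>
  define r where "r = Min {r0 / 2, c * r0 / 2, \<epsilon> / M, 2 * \<kappa> * c\<^sup>2 / M}"
  have r: "r \<le> r0 / 2" "r \<le> c * r0 / 2" "r \<le> \<epsilon> / M" "r \<le> 2 * \<kappa> * c\<^sup>2 / M"
    unfolding r_def by (rule Min_le; simp)+
  show thesis
  proof
    show "r > 0" using r0 c pos \<kappa> by (simp add: r_def)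
    fix y d B \<delta> t
    assume y: "norm (y - z) < r" and \<delta>: "0 < \<delta>" "\<delta> < r" and d: "nrm d \<le> \<delta>"
      and gy: "nrm (g y) \<ge> \<epsilon>" and B: "induced_norm nrm B \<le> M"
      and red: "sufficient_reduction nrm \<beta> (f y) (g y) B \<delta> d" and t: "f y \<le> t"
    define pred where "pred = quad_model (f y) (g y) B 0 - quad_model (f y) (g y) B d"
    have "\<delta> \<le> \<epsilon> / M" using \<delta> r by linarith
    then have pred: "pred \<ge> \<beta> * \<epsilon> * \<delta>"
      using predicted_reduction_ge[OF nrm red pos \<delta>(1) gy B] by (simp add: pred_def)
    then have pred_pos: "pred > 0" using pos \<delta> by (smt (verit) mult_pos_pos)
    have cd: "c * norm d \<le> \<delta>" using c(2)[of d] d by linarith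
    have nd: "norm d < r0 / 2"
    proof -
      have "c * norm d < c * (r0 / 2)" using cd \<delta> r(2) by simp
      then show ?thesis using c(1) by simp
    qed
    have "y \<in> ball z r0" "y + d \<in> ball z r0"
      using y r(1) nd r0(1) norm_triangle_ineq[of "y - z" d]
      by (auto simp: dist_norm norm_minus_commute[of z] algebra_simps)
    from r0(2)[OF this] have "\<bar>f (y + d) - f y - g y \<bullet> d\<bar> \<le> \<kappa> * (c * norm d)"
      by (simp add: mult.assoc)
    also have "\<dots> \<le> \<kappa> * \<delta>" using cd \<kappa> by (intro mult_left_mono) auto
    finally have lin: "f (y + d) - f y - g y \<bullet> d \<le> \<kappa> * \<delta>" by simp
    have nB: "c * norm (B *v d) \<le> M * \<delta>"
    proof -
      have "c * norm (B *v d) \<le> induced_norm nrm B * nrm d"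
        using c(2)[of "B *v d"] nrm_matrix_vector_le[OF nrm, of B d] by linarith
      also have "\<dots> \<le> M * \<delta>"
        using B d pos(3) nrm by (intro mult_mono) (auto simp: is_norm_def)
      finally show ?thesis .
    qed
    have quad: "- (d \<bullet> (B *v d)) / 2 \<le> \<kappa> * \<delta>"
    proof -
      have "- (d \<bullet> (B *v d)) \<le> norm d * norm (B *v d)"
        using Cauchy_Schwarz_ineq2[of d "B *v d"] by linarith
      then have "c\<^sup>2 * (- (d \<bullet> (B *v d))) \<le> c\<^sup>2 * (norm d * norm (B *v d))"
        by (rule mult_left_mono) simp
      also have "\<dots> = (c * norm d) * (c * norm (B *v d))"
        by (simp add: power2_eq_square)
      also have "\<dots> \<le> \<delta> * (M * \<delta>)"
        using cd nB c(1) \<delta>(1) by - (rule mult_mono, auto)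
      also have "\<dots> \<le> \<delta> * (2 * \<kappa> * c\<^sup>2)"
      proof -
        have "\<delta> \<le> 2 * \<kappa> * c\<^sup>2 / M" using \<delta> r by linarith
        then show ?thesis using pos(3) \<delta>(1) by (intro mult_left_mono) (auto simp: field_simps)
      qed
      finally have "c\<^sup>2 * (- (d \<bullet> (B *v d))) \<le> c\<^sup>2 * (2 * (\<kappa> * \<delta>))"
        by (simp add: algebra_simps)
      then have "- (d \<bullet> (B *v d)) \<le> 2 * (\<kappa> * \<delta>)"
        using c(1) by (subst (asm) mult_le_cancel_left_pos) auto
      then show ?thesis by simp
    qed
    have "pred = - (g y \<bullet> d) - (d \<bullet> (B *v d)) / 2"
      by (simp add: pred_def quad_model_def)
    then have "t - f (y + d) \<ge> pred - 2 * \<kappa> * \<delta>" using lin quad t by simp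
    moreover have "2 * \<kappa> * \<delta> \<le> (1 - \<mu>) * pred"
      using mult_left_mono[OF pred, of "1 - \<mu>"] \<mu> by (simp add: \<kappa>_def mult.assoc)
    ultimately have "t - f (y + d) \<ge> \<mu> * pred" by (simp add: algebra_simps)
    then show "\<mu> \<le> ratio f g B t y d"
      unfolding ratio_def pred_def[symmetric] using pred_pos by (simp add: field_simps)
  qed
qed

section \<open>Stationarity\<close>

text \<open>A bound for all but finitely many terms becomes one for all terms because each term is
  positive.\<close>

lemma liminf_pos_lower_bound:
  fixes h :: "nat \<Rightarrow> real"
  assumes pos: "\<And>k. h k > 0" and ne: "liminf (\<lambda>k. ereal (h k)) \<noteq> 0"
  obtains \<epsilon> where "\<epsilon> > 0" "\<And>k. \<epsilon> \<le> h k"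
proof -
  have "0 \<le> liminf (\<lambda>k. ereal (h k))"
    using pos by (intro Liminf_bounded always_eventually) (auto intro: less_imp_le)
  then have "0 < liminf (\<lambda>k. ereal (h k))" using ne by auto
  then obtain e where e: "0 < ereal e" "ereal e < liminf (\<lambda>k. ereal (h k))"
    using ereal_dense2 by blast
  then have "eventually (\<lambda>k. ereal e < ereal (h k)) sequentially"
    using less_LiminfD by blast
  then obtain K where K: "\<And>k. k \<ge> K \<Longrightarrow> e < h k"
    by (auto simp: eventually_sequentially)
  show thesis
  proof
    show "Min (insert e (h ` {..<K})) > 0" using e pos by simp
    show "Min (insert e (h ` {..<K})) \<le> h k" for k
    proof (cases "k < K")
      case False
      then show ?thesis using K[of k] by (intro order_trans[OF Min_le[of _ e]]) auto
    qed (intro Min_le, auto)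
  qed
qed

theorem theorem10:
  fixes nrm :: "real ^ 'n \<Rightarrow> real"
    and f :: "real ^ 'n \<Rightarrow> real" and g :: "real ^ 'n \<Rightarrow> real ^ 'n"
    and x :: "nat \<Rightarrow> real ^ 'n" and B :: "nat \<Rightarrow> real ^ 'n ^ 'n"
    and d :: "nat \<Rightarrow> nat \<Rightarrow> real ^ 'n" and p :: "nat \<Rightarrow> nat"
    and T \<Delta> \<eta> :: "nat \<Rightarrow> real" and N :: nat
    and \<mu>1 \<mu>2 \<rho>1 \<rho>2 \<beta> M :: real
  assumes "is_norm nrm"
    and "\<And>y. GDERIV f y :> g y" and "continuous_on UNIV g"
    and "bdd_below (f ` {y. f y \<le> f (x 0)})"
    and "N \<ge> 1" and "\<And>i. 0 \<le> \<eta> i \<and> \<eta> i < 1"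
    and "T = T_first N \<eta> (\<lambda>k. f (x k)) \<or> T = T_second N \<eta> (\<lambda>k. f (x k))"
    and "0 < \<mu>1" and "\<mu>1 \<le> \<mu>2" and "\<mu>2 < 1"
    and "0 < \<rho>1" and "\<rho>1 < 1" and "1 \<le> \<rho>2"
    and "\<And>k. transpose (B k) = B k"
    and "NMTR_run nrm \<mu>1 \<mu>2 \<rho>1 \<rho>2 f g B T x \<Delta> p d"
    and "\<And>k. g (x k) \<noteq> 0"
    and "0 < \<beta>" and "\<beta> < 1"
    and "\<And>k i. i \<le> p k \<Longrightarrow>
           sufficient_reduction nrm \<beta> (f (x k)) (g (x k)) (B k) (\<rho>1 ^ i * \<Delta> k) (d k i)"
    and "M > 0" and "\<And>k. induced_norm nrm (B k) \<le> M"
  shows "liminf (\<lambda>k. ereal (nrm (g (x k)))) = 0"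
proof (rule ccontr)
  note nrm = assms(1) and \<rho>1 = assms(11,12) and \<rho>2 = assms(13)
  define F where "F k = f (x k)" for k
  define s where "s k = \<rho>1 ^ p k * \<Delta> k" for k
  define q where "q k = ratio f g (B k) (T k) (x k) (d k (p k))" for k
  have T: "T = T_first N \<eta> F \<or> T = T_second N \<eta> F"
    using assms(7) by (simp add: F_def[abs_def])
  have start: "\<Delta> 0 = nrm (g (x 0))"
    and trial: "\<And>k i. i \<le> p k \<Longrightarrow> nrm (d k i) \<le> \<rho>1 ^ i * \<Delta> k"
    and reject: "\<And>k i. i < p k \<Longrightarrow> ratio f g (B k) (T k) (x k) (d k i) < \<mu>1"
    and accept: "\<And>k. \<mu>1 \<le> q k"
    and step: "\<And>k. x (Suc k) = x k + d k (p k)"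
    and radius: "\<And>k. \<Delta> (Suc k) = (if q k \<ge> \<mu>2 then \<rho>2 * s k else s k)"
    using assms(15) by (auto simp: NMTR_run_def s_def q_def)
  have g_pos: "nrm (g (x k)) > 0" for k
    using nrm assms(16)[of k] unfolding is_norm_def by (metis less_le)
  have \<Delta>_pos: "\<Delta> k > 0" for k
    by (induction k) (use start g_pos radius \<rho>1 \<rho>2 in \<open>auto simp: s_def\<close>)
  then have s_pos: "s k > 0" for k using \<rho>1 by (simp add: s_def)
  have \<Delta>_le: "\<Delta> (Suc k) \<le> \<rho>2 * s k" for k
    using radius \<rho>2 s_pos[of k] by auto
  have s_le: "s k \<le> \<Delta> k" for k
    using \<rho>1 \<Delta>_pos[of k] by (simp add: s_def mult_le_cancel_right1 power_le_one)

  assume "\<not> liminf (\<lambda>k. ereal (nrm (g (x k)))) = 0"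
  then obtain \<epsilon> where \<epsilon>: "\<epsilon> > 0" "\<And>k. \<epsilon> \<le> nrm (g (x k))"
    using liminf_pos_lower_bound[of "\<lambda>k. nrm (g (x k))"] g_pos by blast

  define a where "a k = min (s k) (\<epsilon> / M)" for k
  define c where "c = \<mu>1 * (\<beta> * \<epsilon>)"
  have a_pos: "a k > 0" for k using s_pos \<epsilon> assms(20) by (simp add: a_def)
  have c: "c > 0" using \<epsilon> assms(8,17) by (simp add: c_def)
  have descent: "F (Suc k) \<le> f_max N F k - c * a k" for k
  proof -
    define pred where
      "pred = quad_model (f (x k)) (g (x k)) (B k) 0 - quad_model (f (x k)) (g (x k)) (B k) (d k (p k))"
    have pred: "pred \<ge> \<beta> * \<epsilon> * a k"
      unfolding pred_def a_def s_def
      using predicted_reduction_ge[OF nrm assms(19)[OF order_refl, of k] assms(17) \<epsilon>(1) assms(20)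
          _ \<epsilon>(2) assms(21)] s_pos[of k] by (simp add: s_def)
    moreover have "\<beta> * \<epsilon> * a k > 0" using \<epsilon> assms(17) a_pos by simp
    ultimately have "pred > 0" by linarith
    then have "\<mu>1 * pred \<le> T k - F (Suc k)"
      using accept[of k] by (simp add: q_def ratio_def pred_def[symmetric] F_def step field_simps)
    moreover have "c * a k \<le> \<mu>1 * pred"
      using mult_left_mono[OF pred, of \<mu>1] assms(8) by (simp add: c_def mult.assoc)
    ultimately show ?thesis
      using nonmonotone_term_le_f_max[OF assms(6) T, of k] by linarith
  qed
  have "F (Suc k) \<le> f_max N F k" for k
    using descent[of k] mult_pos_pos[OF c a_pos[of k]] by linarith
  from f_max_antimono[OF this, of 0] have "F k \<le> F 0" for k
    using f_max_ge[of 0 k N F] by (fastforce simp: f_max_def intro: order_trans)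
  then have "F k \<in> f ` {y. f y \<le> f (x 0)}" for k by (auto simp: F_def)
  then obtain L where L: "\<And>k. L \<le> F k" using assms(4) by (meson bdd_below.E)
  have growth: "a (Suc k) \<le> \<rho>2 * a k" for k
  proof -
    have "s (Suc k) \<le> \<rho>2 * s k" using s_le[of "Suc k"] \<Delta>_le[of k] by linarith
    moreover have "\<epsilon> / M \<le> \<rho>2 * (\<epsilon> / M)"
      using mult_right_mono[OF \<rho>2, of "\<epsilon> / M"] \<epsilon>(1) assms(20) by simp
    ultimately show ?thesis by (auto simp: a_def min_def)
  qed
  have "summable a"
    using descent c less_imp_le[OF a_pos] growth \<rho>2 L by (rule summable_windowed_descent)
  then have "eventually (\<lambda>k. a k < \<epsilon> / M) sequentially"
    using order_tendstoD(2)[OF summable_LIMSEQ_zero, of a "\<epsilon> / M"] \<epsilon>(1) assms(20) by simp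
  \<comment> \<open>As \<open>a\<close> tends to zero, the cap \<open>\<epsilon> / M\<close> is eventually inactive.\<close>
  then have "eventually (\<lambda>k. a k = s k) sequentially"
    by (rule eventually_mono) (auto simp: a_def min_def split: if_splits)
  then have s_sum: "summable s"
    using \<open>summable a\<close> summable_cong by blast

  obtain b where b: "b > 0" "\<And>v. b * norm v \<le> nrm v"
    by (rule is_norm_equivalent[OF nrm]) (rule that)
  have "norm (x (Suc k) - x k) \<le> s k / b" for k
    using b(2)[of "d k (p k)"] trial[of "p k" k] b(1) by (simp add: step s_def field_simps)
  then obtain z where z: "x \<longlonglongrightarrow> z"
    using convergent_of_summable_steps summable_divide[OF s_sum] by (metis convergent_def)
  have "(\<lambda>k. \<rho>2 * s k) \<longlonglongrightarrow> 0"
    using tendsto_mult_right_zero[OF summable_LIMSEQ_zero[OF s_sum]] by simp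
  then have "(\<lambda>k. \<Delta> (Suc k)) \<longlonglongrightarrow> 0"
    by (rule tendsto_sandwich[rotated 3])
      (use \<Delta>_le \<Delta>_pos in \<open>auto intro!: always_eventually less_imp_le\<close>)
  then have \<Delta>_lim: "\<Delta> \<longlonglongrightarrow> 0" by (simp only: filterlim_sequentially_Suc)

  have "isCont g z" using assms(3) by (simp add: continuous_on_eq_continuous_at)
  from ratio_ge_near_point[OF nrm assms(2) this assms(17) \<epsilon>(1) assms(20,10)]
  obtain r where r: "r > 0"
    "\<And>y d B \<delta> t. norm (y - z) < r \<Longrightarrow> 0 < \<delta> \<Longrightarrow> \<delta> < r \<Longrightarrow> nrm d \<le> \<delta> \<Longrightarrow> nrm (g y) \<ge> \<epsilon> \<Longrightarrow>
      induced_norm nrm B \<le> M \<Longrightarrow> sufficient_reduction nrm \<beta> (f y) (g y) B \<delta> d \<Longrightarrow> f y \<le> t \<Longrightarrow>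
      \<mu>2 \<le> ratio f g B t y d" by blast
  have "eventually (\<lambda>k. norm (x k - z) < r \<and> \<Delta> k < r \<and> k \<ge> N) sequentially"
    using tendstoD[OF z r(1)] order_tendstoD(2)[OF \<Delta>_lim r(1)] eventually_ge_at_top[of N]
    by eventually_elim (simp add: dist_norm)
  then obtain K where K: "\<And>k. k \<ge> K \<Longrightarrow> norm (x k - z) < r \<and> \<Delta> k < r \<and> k \<ge> N"
    by (auto simp: eventually_sequentially)
  \<comment> \<open>The first trial step of every late iteration is already very successful.\<close>
  have good: "\<mu>2 \<le> ratio f g (B k) (T k) (x k) (d k 0)" if "k \<ge> K" for k
    using r(2)[of "x k" "\<Delta> k" "d k 0" "B k" "T k"] K[OF that] \<Delta>_pos[of k] trial[of 0 k] \<epsilon>(2)[of k]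
      assms(21)[of k] assms(19)[of 0 k] nonmonotone_term_ge[OF T assms(5), of k]
    by (simp add: F_def)
  have "\<Delta> k \<le> \<Delta> (Suc k)" if "k \<ge> K" for k
  proof -
    have "p k = 0" using reject[of 0 k] good[OF that] assms(9) by fastforce
    then have "\<Delta> (Suc k) = \<rho>2 * \<Delta> k"
      using radius[of k] good[OF that] by (simp add: q_def s_def)
    then show ?thesis using \<rho>2 \<Delta>_pos[of k] by simp
  qed
  then have "\<Delta> K \<le> \<Delta> (K + n)" for n
    by (induction n) (auto intro: order_trans)
  then have "\<Delta> K \<le> 0"
    using LIMSEQ_ignore_initial_segment[OF \<Delta>_lim, of K]
    by (intro LIMSEQ_le_const[of _ 0]) (auto simp: add.commute)
  then show False using \<Delta>_pos[of K] by linarith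
qed

end
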